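(* Let $\mathcal L$ be a transitive subspace of $M_3[\mathbb C]$ with $\dim\mathcal L=6$. Then $\mathcal L$ is strongly regular, that is, for every $\Delta=\mathrm{diag}(b_1,b_2,b_3)$ with $b_1,b_2,b_3$ distinct nonzero complex numbers there exists $X\in\mathcal L$ such that $\det(\Delta X-XJ)\ne0$.
   Context: $M_3[\mathbb C]$ is the space of $3\times3$ complex matrices and $J=\begin{bmatrix}0&0&0\\1&0&0\\0&1&0\end{bmatrix}$. A subspace $\mathcal L\subset M_3[\mathbb C]$ is transitive if $\{Xv:X\in\mathcal L\}=\mathbb C^3$ for every nonzero $v\in\mathbb C^3$. *)

theory Defs
  imports "HOL-Analysis.Analysis"
begin

(* HOL-Analysis provides real scaling of complex matrices only; this is complex scaling.
   The interpretation below yields cmat.subspace and cmat.dim, the notions of linear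
   subspace and of dimension over the complex numbers. *)
definition cmat_scale :: "complex \<Rightarrow> complex^3^3 \<Rightarrow> complex^3^3"
  where "cmat_scale c A = (\<chi> i j. c * A $ i $ j)"

global_interpretation cmat: vector_space cmat_scale
  by unfold_locales (simp_all add: cmat_scale_def vec_eq_iff algebra_simps)

definition J :: "complex^3^3"
  where "J = vector [vector [0, 0, 0],
                     vector [1, 0, 0],
                     vector [0, 1, 0]]"

definition diag3 :: "complex \<Rightarrow> complex \<Rightarrow> complex \<Rightarrow> complex^3^3"
  where "diag3 a b c = vector [vector [a, 0, 0],
                               vector [0, b, 0],
                               vector [0, 0, c]]"

definition transitive :: "(complex^3^3) set \<Rightarrow> bool"
  where "transitive L \<longleftrightarrow> (\<forall>v :: complex^3. v \<noteq> 0 \<longrightarrow> {X *v v | X. X \<in> L} = UNIV)"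

definition strongly_regular :: "(complex^3^3) set \<Rightarrow> bool"
  where "strongly_regular L \<longleftrightarrow>
    (\<forall>b1 b2 b3. b1 \<noteq> 0 \<and> b2 \<noteq> 0 \<and> b3 \<noteq> 0 \<and> b1 \<noteq> b2 \<and> b1 \<noteq> b3 \<and> b2 \<noteq> b3 \<longrightarrow>
      (\<exists>X \<in> L. det (diag3 b1 b2 b3 ** X - X ** J) \<noteq> 0))"

end

theory Submission
  imports Defs
begin

text \<open>
  Suppose that \<open>T X = \<Delta> X - X J\<close> is singular for every \<open>X \<in> L\<close>. Since \<open>\<Delta>\<close> is invertible and
  \<open>J\<close> is nilpotent, \<open>T\<close> is injective, so \<open>T L\<close> is a six-dimensional space of singular matrices.
  By a theorem of Dieudonne its members have a common kernel vector \<open>v\<close> or a common left kernel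
  vector \<open>u\<close>. In the first case the first coordinate of \<open>X (b\<^sub>1 v - J v)\<close> vanishes for all
  \<open>X \<in> L\<close>; in the second case, as \<open>J e\<^sub>3 = 0\<close>, every \<open>X e\<^sub>3\<close> is annihilated by \<open>u \<Delta>\<close>.
  Both contradict transitivity.

  Dieudonne's theorem is reduced to a space \<open>M\<close> containing \<open>diag(1,1,0)\<close>. Expanding
  \<open>det (Z + t diag(1,1,0)) = 0\<close> in \<open>t\<close> shows that for every \<open>Z \<in> M\<close> the corner entry is 0 and
  the last row is orthogonal to the last column. If some \<open>Y \<in> M\<close> has both of these nonzero, then
  polarising at \<open>Y\<close> yields three linear equations that cut out \<open>M\<close> exactly, but they have a
  solution whose last row and last column are not orthogonal.
\<close>

section \<open>Complex matrices with the matrix units as a basis\<close>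

definition entry_mat :: "'n::finite \<Rightarrow> 'n \<Rightarrow> complex^'n^'n"
  where "entry_mat i j = (\<chi> a b. if a = i \<and> b = j then 1 else 0)"

lemma entry_mat_nth [simp]: "entry_mat i j $ a $ b = (if a = i \<and> b = j then 1 else 0)"
  by (simp add: entry_mat_def)

lemma cmat_scale_nth [simp]: "cmat_scale c A $ i $ j = c * A $ i $ j"
  by (simp add: cmat_scale_def)

abbreviation entry_basis :: "(complex^3^3) set"
  where "entry_basis \<equiv> (\<lambda>(i, j). entry_mat i j) ` UNIV"

lemma inj_entry_mat: "inj (\<lambda>(i, j). entry_mat i j :: complex^'n::finite^'n)"
proof (rule injI, clarsimp)
  fix i j k l :: 'n
  assume "entry_mat i j = entry_mat k l"
  then have "entry_mat i j $ i $ j = entry_mat k l $ i $ j" by simp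
  then show "i = k \<and> j = l" by (simp split: if_splits)
qed

lemma sum_entry_mat_nth:
  "(\<Sum>(a, b)\<in>UNIV. cmat_scale (g a b) (entry_mat a b)) $ i $ j = g i j"
proof -
  have "(\<Sum>(a, b)\<in>UNIV. cmat_scale (g a b) (entry_mat a b)) $ i $ j
      = (\<Sum>p\<in>UNIV. if p = (i, j) then g i j else 0)"
    unfolding sum_component by (rule sum.cong) (auto split: prod.splits)
  then show ?thesis by simp
qed

global_interpretation cmat: finite_dimensional_vector_space cmat_scale entry_basis
proof
  show "finite entry_basis" by simp
  show "cmat.independent entry_basis"
  proof (rule cmat.independent_if_scalars_zero)
    fix f :: "complex^3^3 \<Rightarrow> complex" and x :: "complex^3^3"
    assume 0: "(\<Sum>x\<in>entry_basis. cmat_scale (f x) x) = 0" and "x \<in> entry_basis"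
    then obtain i j where x: "x = entry_mat i j" by auto
    have "(\<Sum>(a, b)\<in>UNIV. cmat_scale (f (entry_mat a b)) (entry_mat a b)) = 0"
      using 0 unfolding sum.reindex[OF inj_entry_mat] by (simp add: o_def case_prod_beta)
    then show "f x = 0"
      using sum_entry_mat_nth[of "\<lambda>a b. f (entry_mat a b)" i j] x by simp
  qed simp
  show "cmat.span entry_basis = UNIV"
  proof (intro set_eqI iffI UNIV_I)
    fix A :: "complex^3^3"
    have "A = (\<Sum>(a, b)\<in>UNIV. cmat_scale (A $ a $ b) (entry_mat a b))"
      by (simp only: vec_eq_iff sum_entry_mat_nth simp_thms)
    also have "\<dots> \<in> cmat.span entry_basis"
      by (intro cmat.span_sum) (auto intro!: cmat.span_scale intro: cmat.span_base)
    finally show "A \<in> cmat.span entry_basis" .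
  qed
qed

section \<open>Dimension counts and matrices of rank at least two\<close>

lemma dim_cmat_le: "cmat.dim S \<le> 9"
proof -
  have "card entry_basis \<le> card (UNIV :: (3 \<times> 3) set)"
    by (rule card_image_le) simp
  then have "cmat.dimension \<le> 9"
    by (simp add: cmat.dimension_def)
  then show ?thesis
    using cmat.dim_subset_UNIV order_trans by blast
qed

text \<open>The span of \<open>S\<close> stays inside \<open>K\<close>, so \<open>w\<close> is
  independent of it. Applied along a chain of linear conditions, each violated by one new matrix,
  this pushes the dimension past 9 and yields contradictions.\<close>

lemma dim_insert_outside_subspace:
  assumes "cmat.subspace K" "S \<subseteq> K" "w \<notin> K"
  shows "cmat.dim (insert w S) = Suc (cmat.dim S)"
proof -
  have "w \<notin> cmat.span S"
    using assms cmat.span_minimal by blast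
  then show ?thesis by (simp add: cmat.dim_insert)
qed

lemma subspace_zero_set:
  assumes add: "\<And>A B. f (A + B) = f A + (f B :: complex)"
    and scale: "\<And>c A. f (cmat_scale c A) = c * f A"
  shows "cmat.subspace {Z. f Z = 0}"
  using add[of 0 0] by (simp add: cmat.subspace_def add scale)

lemma other_indices_3:
  fixes k :: 3
  obtains a b where "a \<noteq> k" "b \<noteq> k" "a \<noteq> b"
proof -
  consider "k = 1" | "k = 2" | "k = 3" using exhaust_3[of k] by blast
  then show ?thesis
    by cases (rule that[of 2 3] that[of 1 3] that[of 1 2]; simp)+
qed

text \<open>If all minors vanished on \<open>M\<close>, polarising at a nonzero entry of some
  \<open>A\<close> would give four independent linear conditions, leaving dimension at most
  5.\<close>

lemma exists_nonzero_minor: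
  assumes M: "cmat.subspace M" and dim: "cmat.dim M > 5"
  obtains A a b c d where "A \<in> M" "A $ a $ b * A $ c $ d \<noteq> A $ a $ d * A $ c $ b"
proof (rule ccontr)
  note thesis = that
  assume "\<not> thesis"
  then have minor: "Y $ a $ b * Y $ c $ d = Y $ a $ d * Y $ c $ b" if "Y \<in> M" for Y a b c d
    using thesis that by blast
  have "\<exists>A\<in>M. A \<noteq> 0"
  proof (rule ccontr)
    assume "\<not> ?thesis"
    then have "M \<subseteq> cmat.span {}" by auto
    then have "cmat.dim M \<le> card ({} :: (complex^3^3) set)" by (rule cmat.dim_le_card) simp
    then show False using dim unfolding card.empty by linarith
  qed
  then obtain A k l where A: "A \<in> M" and kl: "A $ k $ l \<noteq> 0"
    by (auto simp: vec_eq_iff)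
  obtain a b where ab: "a \<noteq> k" "b \<noteq> k" "a \<noteq> b" by (rule other_indices_3)
  obtain c d where cd: "c \<noteq> l" "d \<noteq> l" "c \<noteq> d" by (rule other_indices_3)
  define K where "K i j = {Z :: complex^3^3.
    A $ k $ l * Z $ i $ j + A $ i $ j * Z $ k $ l - A $ k $ j * Z $ i $ l - A $ i $ l * Z $ k $ j = 0}" for i j
  \<comment> \<open>polarisation of the vanishing of the minors at \<open>A\<close>\<close>
  have sub: "cmat.subspace (K i j)" for i j
    unfolding K_def by (rule subspace_zero_set) (simp_all add: algebra_simps)
  have MK: "M \<subseteq> K i j" for i j
  proof
    fix Z assume Z: "Z \<in> M"
    then have AZ: "A + Z \<in> M" using A M cmat.subspace_add by blast
    show "Z \<in> K i j"
      using minor[OF AZ, of k l i j] minor[OF A, of k l i j] minor[OF Z, of k l i j]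
      by (simp add: K_def algebra_simps)
  qed
  \<comment> \<open>For \<open>i\<close> in {a, b} and \<open>j\<close> in {c, d}, the unit at
    \<open>(i, j)\<close> violates \<open>K i j\<close>, because
    \<open>A $ k $ l \<noteq> 0\<close>, and satisfies the other three conditions. Four insertions
    thus reach dimension at least 10.\<close>
  let ?S4 = "insert (entry_mat a c) M"
  let ?S3 = "insert (entry_mat a d) ?S4"
  let ?S2 = "insert (entry_mat b c) ?S3"
  let ?S1 = "insert (entry_mat b d) ?S2"
  have "cmat.dim ?S4 = Suc (cmat.dim M)"
    by (rule dim_insert_outside_subspace[OF sub[of a c]]) (use MK ab cd kl in \<open>auto simp: K_def\<close>)
  moreover have "cmat.dim ?S3 = Suc (cmat.dim ?S4)"
    by (rule dim_insert_outside_subspace[OF sub[of a d]]) (use MK[of a d] ab cd kl in \<open>auto simp: K_def\<close>)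
  moreover have "cmat.dim ?S2 = Suc (cmat.dim ?S3)"
    by (rule dim_insert_outside_subspace[OF sub[of b c]]) (use MK[of b c] ab cd kl in \<open>auto simp: K_def\<close>)
  moreover have "cmat.dim ?S1 = Suc (cmat.dim ?S2)"
    by (rule dim_insert_outside_subspace[OF sub[of b d]]) (use MK[of b d] ab cd kl in \<open>auto simp: K_def\<close>)
  ultimately show False
    using dim dim_cmat_le[of ?S1] by linarith
qed

section \<open>Singular spaces containing \<open>diag110\<close>\<close>

lemma det_3_distinct:
  fixes X :: "complex^3^3"
  assumes "{i, j} = {1, 2 :: 3}"
  shows "det X = X$i$i * X$j$j * X$3$3 + X$i$j * X$j$3 * X$3$i + X$i$3 * X$j$i * X$3$j
    - X$i$i * X$j$3 * X$3$j - X$i$j * X$j$i * X$3$3 - X$i$3 * X$j$j * X$3$i"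
  \<comment> \<open>Swapping the first two rows and also the first two columns preserves the
    determinant, so one formula serves both orders of \<open>i\<close> and \<open>j\<close>.\<close>
  using assms by (auto simp: doubleton_eq_iff det_3 algebra_simps)

abbreviation diag110 :: "complex^3^3"
  where "diag110 \<equiv> diag3 1 1 0"

lemma diag3_nth [simp]:
  "diag3 a b c $ 1 $ 1 = a" "diag3 a b c $ 1 $ 2 = 0" "diag3 a b c $ 1 $ 3 = 0"
  "diag3 a b c $ 2 $ 1 = 0" "diag3 a b c $ 2 $ 2 = b" "diag3 a b c $ 2 $ 3 = 0"
  "diag3 a b c $ 3 $ 1 = 0" "diag3 a b c $ 3 $ 2 = 0" "diag3 a b c $ 3 $ 3 = c"
  by (simp_all add: diag3_def)

text \<open>As \<open>diag110\<close> has rank 2, \<open>det (Z + t diag110)\<close> is quadratic in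
  t. The values at 0, 1 and -1 isolate its coefficients: the corner entry at t^2 and, once that is
  0, minus the row-column product at t.\<close>

lemma singular_space_diag110:
  assumes M: "cmat.subspace M" and D: "diag110 \<in> M"
    and sing: "\<And>Y. Y \<in> M \<Longrightarrow> det Y = 0" and Z: "Z \<in> M"
  shows "Z $ 3 $ 3 = 0" and "Z $ 3 $ 1 * Z $ 1 $ 3 + Z $ 3 $ 2 * Z $ 2 $ 3 = 0"
proof -
  have "Z + diag110 \<in> M" "Z - diag110 \<in> M"
    using M D Z cmat.subspace_add cmat.subspace_diff by blast+
  then have p: "det (Z + diag110) = 0" and m: "det (Z - diag110) = 0"
    using sing by blast+
  have "det (Z + diag110) + det (Z - diag110) - 2 * det Z = 2 * Z $ 3 $ 3"
    by (simp add: det_3 algebra_simps)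
  then show 33: "Z $ 3 $ 3 = 0" using p m sing[OF Z] by simp
  have "det (Z - diag110) - det (Z + diag110) =
      2 * (Z $ 3 $ 1 * Z $ 1 $ 3 + Z $ 3 $ 2 * Z $ 2 $ 3)"
    unfolding det_3 by (simp add: 33) algebra
  then show "Z $ 3 $ 1 * Z $ 1 $ 3 + Z $ 3 $ 2 * Z $ 2 $ 3 = 0"
    unfolding p m by (metis diff_self mult_eq_0_iff zero_neq_numeral)
qed

lemma singular_space_diag110_contradiction:
  assumes M: "cmat.subspace M" and dim: "cmat.dim M = 6" and D: "diag110 \<in> M"
    and sing: "\<And>Y. Y \<in> M \<Longrightarrow> det Y = 0"
    and ij: "{i, j} = {1, 2}"
    and Y: "Y \<in> M" and nz: "Y $ 3 $ i \<noteq> 0" "Y $ j $ 3 \<noteq> 0"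
  shows False
proof -
  have ne: "i \<noteq> j" "i \<noteq> 3" "j \<noteq> 3" "j \<noteq> i" "3 \<noteq> i" "3 \<noteq> j"
    using ij by (auto simp: doubleton_eq_iff)
  have corner: "Z $ 3 $ 3 = 0" if "Z \<in> M" for Z
    using singular_space_diag110(1)[OF M D sing that] .
  have quad: "Z $ 3 $ i * Z $ i $ 3 + Z $ 3 $ j * Z $ j $ 3 = 0" if "Z \<in> M" for Z
    using singular_space_diag110(2)[OF M D sing that] ij
    by (auto simp: doubleton_eq_iff add.commute)
  define K1 where "K1 = {Z :: complex^3^3. Z $ 3 $ 3 = 0}"
  define K2 where "K2 = {Z :: complex^3^3.
    Z $ 3 $ i * Y $ i $ 3 + Z $ 3 $ j * Y $ j $ 3 + Y $ 3 $ i * Z $ i $ 3 + Y $ 3 $ j * Z $ j $ 3 = 0}"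
  \<comment> \<open>the differential of the determinant at \<open>Y\<close>, applied to \<open>Z\<close>\<close>
  define g where "g Z =
      - Y$j$3 * Y$3$j * Z$i$i + Y$j$3 * Y$3$i * Z$i$j + Y$i$3 * Y$3$j * Z$j$i - Y$i$3 * Y$3$i * Z$j$j
      + (Y$i$j * Y$3$i - Y$i$i * Y$3$j) * Z$j$3 + (Y$j$i * Y$3$j - Y$j$j * Y$3$i) * Z$i$3
      + (Y$i$j * Y$j$3 - Y$i$3 * Y$j$j) * Z$3$i + (Y$j$i * Y$i$3 - Y$i$i * Y$j$3) * Z$3$j"
    for Z :: "complex^3^3"
  have g_add: "g (A + B) = g A + g B" and g_scale: "g (cmat_scale c A) = c * g A" for A B c
    by (simp_all add: g_def algebra_simps)
  define K3 where "K3 = {Z. g Z = 0}"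
  have sub: "cmat.subspace K1" "cmat.subspace K2" "cmat.subspace K3"
    unfolding K1_def K2_def K3_def
    by (rule subspace_zero_set; simp add: g_add g_scale algebra_simps)+
  have MK1: "M \<subseteq> K1" using corner by (auto simp: K1_def)
  have MK2: "M \<subseteq> K2"
  proof
    fix Z assume Z: "Z \<in> M"
    then have YZ: "Y + Z \<in> M" using Y M cmat.subspace_add by blast
    show "Z \<in> K2"
      using quad[OF YZ] quad[OF Y] quad[OF Z] unfolding K2_def by simp algebra
  qed
  have MK3: "M \<subseteq> K3"
  proof
    fix Z assume Z: "Z \<in> M"
    have "Y + Z \<in> M" "Y - Z \<in> M" using Y Z M cmat.subspace_add cmat.subspace_diff by blast+
    \<comment> \<open>The part of \<open>det (Y + Z)\<close> odd in \<open>Z\<close> is the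
      differential at \<open>Y\<close> plus \<open>det Z\<close>. The corner terms missing from
      \<open>g\<close> vanish on \<open>M\<close>.\<close>
    then have "det (Y + Z) - det (Y - Z) - 2 * det Z = 0"
      using sing Z by simp
    moreover have "det (Y + Z) - det (Y - Z) - 2 * det Z = 2 * g Z"
      using corner[OF Y] corner[OF Z] by (simp add: det_3_distinct[OF ij] g_def algebra_simps)
    ultimately show "Z \<in> K3" by (simp add: K3_def)
  qed
  let ?p = "Y $ 3 $ i" and ?q = "Y $ 3 $ j" and ?t = "Y $ j $ 3"
  \<comment> \<open>\<open>W\<close> is chosen in \<open>K2\<close> with last row and column not orthogonal; the entry at \<open>(i, j)\<close>, on which
      neither condition depends, is then adjusted to satisfy \<open>g X = 0\<close>.\<close>
  define W where "W = entry_mat j 3 - entry_mat 3 j + cmat_scale ((?t - ?q) / ?p) (entry_mat i 3)"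
  define X where "X = W + cmat_scale (- g W / (?t * ?p)) (entry_mat i j)"
  have gE: "g (entry_mat i j) = ?t * ?p"
    using ne by (simp add: g_def)
  have XK3: "X \<in> K3"
    using nz by (simp add: K3_def X_def g_add g_scale gE del: cmat.scale_minus_left)
  have XK1: "X \<in> K1" using ne by (simp add: K1_def X_def W_def)
  have XK2: "X \<in> K2" using ne nz by (simp add: K2_def X_def W_def)
  have "X $ 3 $ i * X $ i $ 3 + X $ 3 $ j * X $ j $ 3 = - 1"
    using ne by (simp add: X_def W_def)
  then have "X \<notin> M" using quad by force
  \<comment> \<open>The pattern is triangular: the inserted units violate \<open>K3\<close>,
    \<open>K2\<close>, \<open>K1\<close> in turn, and each matrix already inserted satisfies the
    condition in use. With \<open>X\<close> the dimension would be 6 + 4 = 10.\<close>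
  let ?S3 = "insert X M"
  let ?S2 = "insert (entry_mat i j) ?S3"
  let ?S1 = "insert (entry_mat i 3) ?S2"
  let ?S0 = "insert (entry_mat 3 3) ?S1"
  have "cmat.dim ?S3 = Suc (cmat.dim M)"
    by (rule dim_insert_outside_subspace[OF M]) (use \<open>X \<notin> M\<close> in auto)
  moreover have "cmat.dim ?S2 = Suc (cmat.dim ?S3)"
    by (rule dim_insert_outside_subspace[OF sub(3)])
      (use XK3 MK3 gE nz in \<open>auto simp: K3_def\<close>)
  moreover have "cmat.dim ?S1 = Suc (cmat.dim ?S2)"
    by (rule dim_insert_outside_subspace[OF sub(2)])
      (use XK2 MK2 ne nz in \<open>auto simp: K2_def\<close>)
  moreover have "cmat.dim ?S0 = Suc (cmat.dim ?S1)"
    by (rule dim_insert_outside_subspace[OF sub(1)])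
      (use XK1 MK1 ne in \<open>auto simp: K1_def\<close>)
  ultimately show False
    using dim dim_cmat_le[of ?S0] by linarith
qed

lemma singular_space_containing_diag110:
  assumes M: "cmat.subspace M" and dim: "cmat.dim M = 6" and D: "diag110 \<in> M"
    and sing: "\<And>Y. Y \<in> M \<Longrightarrow> det Y = 0"
  shows "(\<forall>Y\<in>M. \<forall>i. Y $ i $ 3 = 0) \<or> (\<forall>Y\<in>M. \<forall>i. Y $ 3 $ i = 0)"
proof (rule ccontr)
  assume neg: "\<not> ?thesis"
  have corner: "Z $ 3 $ 3 = 0" if "Z \<in> M" for Z
    using singular_space_diag110(1)[OF M D sing that] .
  define col row :: "complex^3^3 \<Rightarrow> bool"
    where "col Y \<longleftrightarrow> Y $ 1 $ 3 = 0 \<and> Y $ 2 $ 3 = 0" and "row Y \<longleftrightarrow> Y $ 3 $ 1 = 0 \<and> Y $ 3 $ 2 = 0" for Y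
  obtain U V where UV: "U \<in> M" "\<not> col U" "V \<in> M" "\<not> row V"
    using neg corner unfolding col_def row_def forall_3 by blast
  \<comment> \<open>If neither \<open>U\<close> nor \<open>V\<close> serves, \<open>U\<close> has
    zero last row and \<open>V\<close> zero last column, so \<open>U + V\<close> takes its last
    column from \<open>U\<close> and its last row from \<open>V\<close>.\<close>
  have "\<exists>Y\<in>M. \<not> col Y \<and> \<not> row Y"
  proof (cases "row U \<and> col V")
    case True
    then have "\<not> col (U + V) \<and> \<not> row (U + V)"
      using UV by (auto simp: col_def row_def)
    then show ?thesis using UV M cmat.subspace_add by blast
  qed (use UV in blast)
  then obtain Y where Y: "Y \<in> M" "\<not> col Y" "\<not> row Y" by blast
  \<comment> \<open>Otherwise the last row and column would each have a single nonzero entry, in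
    matching positions, and could not be orthogonal.\<close>
  then have "Y $ 3 $ 1 \<noteq> 0 \<and> Y $ 2 $ 3 \<noteq> 0 \<or> Y $ 3 $ 2 \<noteq> 0 \<and> Y $ 1 $ 3 \<noteq> 0"
    using singular_space_diag110(2)[OF M D sing Y(1)] by (auto simp: col_def row_def)
  then show False
    using singular_space_diag110_contradiction[OF M dim D sing _ Y(1), of 1 2]
      singular_space_diag110_contradiction[OF M dim D sing _ Y(1), of 2 1]
    by (auto simp: insert_commute)
qed


section \<open>Normal form of a singular matrix of rank two\<close>

definition outer :: "complex^3 \<Rightarrow> complex^3 \<Rightarrow> complex^3^3"
  where "outer x y = (\<chi> i j. x $ i * y $ j)"

lemma matrix_mult_outer: "Q ** outer x y = outer (Q *v x) y"
  by (simp add: vec_eq_iff outer_def matrix_matrix_mult_def matrix_vector_mult_def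
      sum_distrib_right mult.assoc)

lemma outer_mult_matrix: "outer x y ** P = outer x (y v* P)"
  by (simp add: vec_eq_iff outer_def matrix_matrix_mult_def vector_matrix_mult_def
      sum_distrib_left mult.assoc mult.commute mult.left_commute)

lemma singular_block_outer:
  fixes A :: "complex^3^3"
  assumes z: "\<And>i. A $ i $ 3 = 0" "\<And>j. A $ 3 $ j = 0"
    and det: "A $ 1 $ 1 * A $ 2 $ 2 = A $ 1 $ 2 * A $ 2 $ 1"
  obtains x y where "A = outer x y"
proof -
  consider "A $ 1 $ 1 \<noteq> 0" | "A $ 1 $ 2 \<noteq> 0" | "A $ 1 $ 1 = 0" "A $ 1 $ 2 = 0" by blast
  then show ?thesis
  proof cases
    case 1
    then have "A = outer (vector [1, A $ 2 $ 1 / A $ 1 $ 1, 0]) (A $ 1)"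
      using z det by (simp add: vec_eq_iff forall_3 outer_def field_simps)
    then show ?thesis by (rule that)
  next
    case 2
    then have "A = outer (vector [1, A $ 2 $ 2 / A $ 1 $ 2, 0]) (A $ 1)"
      using z det by (simp add: vec_eq_iff forall_3 outer_def field_simps)
    then show ?thesis by (rule that)
  next
    case 3
    then have "A = outer (vector [0, 1, 0]) (A $ 2)"
      using z by (simp add: vec_eq_iff forall_3 outer_def)
    then show ?thesis by (rule that)
  qed
qed

lemma exists_invertible_with_column_3:
  fixes v :: "complex^3"
  assumes "v \<noteq> 0"
  obtains P :: "complex^3^3" where "invertible P" "\<And>i. P $ i $ 3 = v $ i"
proof -
  consider "v $ 1 \<noteq> 0" | "v $ 2 \<noteq> 0" | "v $ 3 \<noteq> 0"
    using assms by (auto simp: vec_eq_iff forall_3)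
  then show ?thesis
  proof cases
    case 1
    let ?P = "vector [vector [0, 0, v $ 1], vector [1, 0, v $ 2], vector [0, 1, v $ 3]] :: complex^3^3"
    have "invertible ?P" "\<forall>i. ?P $ i $ 3 = v $ i"
      using 1 by (simp_all add: invertible_det_nz det_3 forall_3)
    then show ?thesis using that[of ?P] by blast
  next
    case 2
    let ?P = "vector [vector [1, 0, v $ 1], vector [0, 0, v $ 2], vector [0, 1, v $ 3]] :: complex^3^3"
    have "invertible ?P" "\<forall>i. ?P $ i $ 3 = v $ i"
      using 2 by (simp_all add: invertible_det_nz det_3 forall_3)
    then show ?thesis using that[of ?P] by blast
  next
    case 3
    let ?P = "vector [vector [1, 0, v $ 1], vector [0, 1, v $ 2], vector [0, 0, v $ 3]] :: complex^3^3"
    have "invertible ?P" "\<forall>i. ?P $ i $ 3 = v $ i"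
      using 3 by (simp_all add: invertible_det_nz det_3 forall_3)
    then show ?thesis using that[of ?P] by blast
  qed
qed

lemma det_0_kernel:
  fixes A :: "complex^'n^'n"
  assumes "det A = 0"
  obtains v where "v \<noteq> 0" "A *v v = 0"
  using assms matrix_left_invertible_ker[of A] invertible_left_inverse[of A] invertible_det_nz[of A]
  by blast

text \<open>A kernel vector as last column of \<open>P\<close> and a left kernel vector as last row
  of \<open>Q\<close> clear the last column and row of \<open>Q ** A ** P\<close>. The nonzero minor
  makes the remaining block invertible.\<close>

lemma rank_2_normal_form:
  fixes A :: "complex^3^3"
  assumes det: "det A = 0" and minor: "A $ a $ b * A $ c $ d \<noteq> A $ a $ d * A $ c $ b"
  obtains Q P where "invertible Q" "invertible P" "Q ** A ** P = diag110"
proof -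
  obtain v where v: "v \<noteq> 0" "A *v v = 0" using det by (rule det_0_kernel)
  have "det (transpose A) = 0" using det by (simp add: det_transpose)
  then obtain u where u: "u \<noteq> 0" "transpose A *v u = 0" by (rule det_0_kernel)
  obtain P :: "complex^3^3" where P: "invertible P" "\<And>i. P $ i $ 3 = v $ i"
    using exists_invertible_with_column_3[OF v(1)] by metis
  obtain R :: "complex^3^3" where R: "invertible R" "\<And>i. R $ i $ 3 = u $ i"
    using exists_invertible_with_column_3[OF u(1)] by metis
  define Q where "Q = transpose R"
  have Q: "invertible Q" using R(1) by (simp add: Q_def invertible_det_nz det_transpose)
  obtain Q' where Q': "Q' ** Q = mat 1" using Q by (auto simp: invertible_def)
  obtain P' where P': "P ** P' = mat 1" using P(1) by (auto simp: invertible_def)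
  define B where "B = Q ** A ** P"
  have "(A ** P) $ i $ 3 = (A *v v) $ i" for i
    by (simp add: matrix_matrix_mult_def matrix_vector_mult_def P(2))
  then have B3: "B $ i $ 3 = 0" for i
    unfolding B_def matrix_mul_assoc[symmetric] using v(2)
    by (subst matrix_matrix_mult_def) simp
  have "(Q ** A) $ 3 $ j = (transpose A *v u) $ j" for j
    by (simp add: matrix_matrix_mult_def matrix_vector_mult_def Q_def transpose_def R(2) mult.commute)
  then have B3': "B $ 3 $ j = 0" for j
    unfolding B_def using u(2) by (subst matrix_matrix_mult_def) simp
  define \<delta> where "\<delta> = B $ 1 $ 1 * B $ 2 $ 2 - B $ 1 $ 2 * B $ 2 $ 1"
  have "\<delta> \<noteq> 0"
  \<comment> \<open>Otherwise \<open>B\<close>, and with it \<open>A\<close>, would be an outer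
    product, all of whose minors vanish.\<close>
  proof
    assume "\<delta> = 0"
    then obtain x y where xy: "B = outer x y"
      using singular_block_outer[OF B3 B3'] unfolding \<delta>_def by auto
    have "A = (Q' ** Q) ** A ** (P ** P')" by (simp add: Q' P')
    also have "\<dots> = Q' ** B ** P'" unfolding B_def by (simp only: matrix_mul_assoc)
    finally have "A = outer (Q' *v x) (y v* P')"
      by (simp add: xy matrix_mult_outer outer_mult_matrix)
    then show False using minor by (simp add: outer_def)
  qed
  \<comment> \<open>\<open>S\<close> is the inverse of the upper left block of \<open>B\<close>,
    bordered by 1.\<close>
  define S :: "complex^3^3" where "S = vector [vector [B $ 2 $ 2 / \<delta>, - B $ 1 $ 2 / \<delta>, 0],
    vector [- B $ 2 $ 1 / \<delta>, B $ 1 $ 1 / \<delta>, 0], vector [0, 0, 1]]"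
  have "det S = 1 / \<delta>"
    using \<open>\<delta> \<noteq> 0\<close> by (simp add: S_def det_3 field_simps) (simp add: \<delta>_def algebra_simps)
  then have "invertible S" using \<open>\<delta> \<noteq> 0\<close> by (simp add: invertible_det_nz)
  moreover have "S ** B = diag110"
    using \<open>\<delta> \<noteq> 0\<close>
    by (simp add: vec_eq_iff forall_3 matrix_matrix_mult_def sum_3 S_def B3 B3' field_simps)
      (simp add: \<delta>_def algebra_simps)
  ultimately show ?thesis
    using that[of "S ** Q" P] Q P(1) by (simp add: invertible_mult B_def matrix_mul_assoc)
qed

section \<open>Common kernels of six-dimensional singular spaces\<close>

lemma cmat_image_linear:
  assumes M: "cmat.subspace M" and f: "Vector_Spaces.linear cmat_scale cmat_scale f" and "inj_on f M"
  shows "cmat.subspace (f ` M)" "cmat.dim (f ` M) = cmat.dim M"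
proof -
  interpret f: Vector_Spaces.linear cmat_scale cmat_scale f by (rule f)
  interpret pair: finite_dimensional_vector_space_pair_1 cmat_scale entry_basis cmat_scale
    by unfold_locales
  show "cmat.subspace (f ` M)" using M by (rule f.subspace_image)
  have span: "cmat.span M = M" using M by (simp add: cmat.span_eq_iff)
  show "cmat.dim (f ` M) = cmat.dim M"
    by (rule pair.dim_image_eq[OF f]) (simp only: span assms(3))
qed

lemma linear_cmatI:
  assumes "\<And>A B. f (A + B) = f A + f B" "\<And>c A. f (cmat_scale c A) = cmat_scale c (f A)"
  shows "Vector_Spaces.linear cmat_scale cmat_scale f"
  by unfold_locales (simp_all add: assms)

lemma cmat_scale_matrix_mult:
  "cmat_scale c A ** B = cmat_scale c (A ** B)" "A ** cmat_scale c B = cmat_scale c (A ** B)"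
  by (simp_all add: vec_eq_iff matrix_matrix_mult_def sum_distrib_left mult.assoc mult.left_commute)

text \<open>The equivalence \<open>Y\<close> to \<open>Q ** Y ** P\<close> preserves dimension and
  singularity and can be chosen to put \<open>diag110\<close> in the image. Pulled back, a zero last
  column gives the kernel vector \<open>P\<close> e3, a zero last row the left kernel vector e3
  \<open>Q\<close>.\<close>

lemma singular_space_dim_6:
  assumes M: "cmat.subspace M" and dim: "cmat.dim M = 6"
    and sing: "\<And>Y. Y \<in> M \<Longrightarrow> det Y = 0"
  obtains v where "v \<noteq> 0" "\<And>Y. Y \<in> M \<Longrightarrow> Y *v v = 0"
  | u where "u \<noteq> 0" "\<And>Y. Y \<in> M \<Longrightarrow> u v* Y = 0"
proof -
  have "cmat.dim M > 5" using dim by simp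
  then obtain A a b c d where A: "A \<in> M" "A $ a $ b * A $ c $ d \<noteq> A $ a $ d * A $ c $ b"
    using exists_nonzero_minor[OF M] by blast
  obtain Q P where QP: "invertible Q" "invertible P" "Q ** A ** P = diag110"
    using rank_2_normal_form[OF sing[OF A(1)] A(2)] .
  define f where "f Y = Q ** Y ** P" for Y
  have lin: "Vector_Spaces.linear cmat_scale cmat_scale f"
    by (rule linear_cmatI)
      (simp_all add: f_def matrix_add_ldistrib cmat_scale_matrix_mult,
        simp add: vec_eq_iff matrix_matrix_mult_def distrib_right sum.distrib)
  obtain Q' where Q': "Q' ** Q = mat 1" using QP(1) by (auto simp: invertible_def)
  obtain P' where P': "P ** P' = mat 1" "P' ** P = mat 1"
    using QP(2) by (auto simp: invertible_def)
  obtain Q'' where Q'': "Q ** Q'' = mat 1" using QP(1) by (auto simp: invertible_def)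
  have left: "Q' ** f Y = Y ** P" for Y
    unfolding f_def by (simp add: matrix_mul_assoc Q')
  have right: "f Y ** P' = Q ** Y" for Y
    unfolding f_def matrix_mul_assoc[symmetric] by (simp add: P')
  have inv: "Q' ** f Y ** P' = Y" for Y
    unfolding left matrix_mul_assoc[symmetric] by (simp add: P')
  have inj: "inj_on f M" by (rule inj_on_inverseI) (rule inv)
  have "(\<forall>Y\<in>f ` M. \<forall>i. Y $ i $ 3 = 0) \<or> (\<forall>Y\<in>f ` M. \<forall>i. Y $ 3 $ i = 0)"
  proof (rule singular_space_containing_diag110)
    show "cmat.subspace (f ` M)" "cmat.dim (f ` M) = 6"
      using cmat_image_linear[OF M lin inj] dim by simp_all
    show "diag110 \<in> f ` M" using A(1) QP(3) f_def by (metis imageI)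
    show "det Y = 0" if "Y \<in> f ` M" for Y
      using that sing by (auto simp: f_def det_mul)
  qed
  then show ?thesis
  proof
    assume col: "\<forall>Y\<in>f ` M. \<forall>i. Y $ i $ 3 = 0"
    let ?e = "axis 3 1 :: complex^3"
    show ?thesis
    proof (rule that(1))
      have "P' *v (P *v ?e) = ?e"
        by (simp add: matrix_vector_mul_assoc P')
      then show "P *v ?e \<noteq> 0" by auto
      fix Y assume "Y \<in> M"
      then have "f Y *v ?e = 0"
        using col by (simp add: vec_eq_iff matrix_vector_mult_def axis_def sum_3)
      then have "Q' *v (f Y *v ?e) = 0" by simp
      then show "Y *v (P *v ?e) = 0"
        by (simp add: matrix_vector_mul_assoc left)
    qed
  next
    assume row: "\<forall>Y\<in>f ` M. \<forall>i. Y $ 3 $ i = 0"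
    let ?e = "axis 3 1 :: complex^3"
    show ?thesis
    proof (rule that(2))
      have "(?e v* Q) v* Q'' = ?e"
        by (simp add: vector_matrix_mul_assoc Q'')
      then show "?e v* Q \<noteq> 0" by auto
      fix Y assume "Y \<in> M"
      then have "?e v* f Y = 0"
        using row by (simp add: vec_eq_iff vector_matrix_mult_def axis_def sum_3)
      then have "(?e v* f Y) v* P' = 0" by simp
      then show "(?e v* Q) v* Y = 0"
        by (simp add: vector_matrix_mul_assoc right)
    qed
  qed
qed

section \<open>Singularity of \<open>\<Delta> X - X J\<close> against transitivity\<close>

lemma J_nth [simp]:
  "J $ 1 $ j = 0" "J $ 2 $ 1 = 1" "J $ 2 $ 2 = 0" "J $ 2 $ 3 = 0"
  "J $ 3 $ 1 = 0" "J $ 3 $ 2 = 1" "J $ 3 $ 3 = 0"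
  using exhaust_3[of j] by (auto simp: J_def)

lemmas mult_3 = matrix_matrix_mult_def matrix_vector_mult_def vector_matrix_mult_def sum_3

theorem theorem29:
  fixes L :: "(complex^3^3) set"
  assumes "cmat.subspace L"
    and "transitive L"
    and "cmat.dim L = 6"
  shows "strongly_regular L"
  unfolding strongly_regular_def
proof (intro allI impI, rule ccontr)
  fix b1 b2 b3 :: complex
  assume b: "b1 \<noteq> 0 \<and> b2 \<noteq> 0 \<and> b3 \<noteq> 0 \<and> b1 \<noteq> b2 \<and> b1 \<noteq> b3 \<and> b2 \<noteq> b3"
  let ?\<Delta> = "diag3 b1 b2 b3"
  assume "\<not> (\<exists>X\<in>L. det (?\<Delta> ** X - X ** J) \<noteq> 0)"
  then have sing: "det (?\<Delta> ** X - X ** J) = 0" if "X \<in> L" for X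
    using that by blast
  define T where "T X = ?\<Delta> ** X - X ** J" for X
  have trans: "\<exists>X\<in>L. X *v v = w" if "v \<noteq> 0" for v w
  proof -
    have "{X *v v |X. X \<in> L} = UNIV"
      using assms(2) that by (simp add: transitive_def)
    then have "w \<in> {X *v v |X. X \<in> L}" by simp
    then show ?thesis by blast
  qed
  have add: "T (A + B) = T A + T B" and scale: "T (cmat_scale c A) = cmat_scale c (T A)" for A B c
    by (simp_all add: T_def vec_eq_iff matrix_matrix_mult_def algebra_simps sum.distrib
        sum_distrib_left)
  have lin: "Vector_Spaces.linear cmat_scale cmat_scale T"
    by (rule linear_cmatI) (rule add scale)+
  interpret T: Vector_Spaces.linear cmat_scale cmat_scale T by (rule lin)
  \<comment> \<open>The columns of \<open>X ** J\<close> are the second and third columns of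
    \<open>X\<close>, then 0. Invertibility of \<open>\<Delta>\<close> thus kills the columns of
    \<open>X\<close> from right to left.\<close>
  have "X = 0" if "T X = 0" for X
    using that b by (auto simp: T_def vec_eq_iff forall_3 mult_3)
  then have "inj T" by (simp add: T.inj_iff_eq_0)
  then have inj: "inj_on T L" by (rule inj_on_subset) simp
  show False
  proof (rule singular_space_dim_6)
    show "cmat.subspace (T ` L)" "cmat.dim (T ` L) = 6"
      using cmat_image_linear[OF assms(1) lin inj] assms(3) by simp_all
    show "det Y = 0" if "Y \<in> T ` L" for Y
      using that sing by (auto simp: T_def)
  next
    fix v :: "complex^3"
    assume v: "v \<noteq> 0" "\<And>Y. Y \<in> T ` L \<Longrightarrow> Y *v v = 0"
    define w where "w = b1 *s v - J *v v"
    \<comment> \<open>\<open>J\<close> is nilpotent, so the nonzero \<open>b1\<close> is not an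
      eigenvalue of it.\<close>
    have "w \<noteq> 0"
    proof
      assume "w = 0"
      then have "v = 0" using b by (auto simp: w_def vec_eq_iff forall_3 mult_3)
      then show False using v(1) by simp
    qed
    then obtain X where X: "X \<in> L" "X *v w = axis 1 1" using trans by blast
    have "(X *v w) $ 1 = (T X *v v) $ 1"
      by (simp add: T_def w_def mult_3 algebra_simps)
    also have "\<dots> = 0" using v(2) X(1) by simp
    finally show False using X(2) by (simp add: axis_def)
  next
    fix u :: "complex^3"
    assume u: "u \<noteq> 0" "\<And>Y. Y \<in> T ` L \<Longrightarrow> u v* Y = 0"
    then obtain k where k: "u $ k \<noteq> 0" by (auto simp: vec_eq_iff)
    \<comment> \<open>Since \<open>J\<close> e3 = 0, the last entry of \<open>u v* T X\<close> is u
      \<open>\<Delta>\<close> X e3, which for this \<open>X\<close> is the k-th entry of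
      \<open>u\<close> times the k-th diagonal entry of \<open>\<Delta>\<close>, hence
      nonzero.\<close>
    obtain X where X: "X \<in> L" "X *v axis 3 1 = axis k 1"
      using trans[of "axis 3 1"] by auto
    have X3: "X $ i $ 3 = axis k 1 $ i" for i
      using arg_cong[OF X(2), of "\<lambda>x. x $ i"] by (simp add: mult_3 axis_def)
    have "(u v* T X) $ 3 = 0" using u(2) X(1) by simp
    then have "u $ 1 * b1 * axis k 1 $ 1 + u $ 2 * b2 * axis k 1 $ 2 + u $ 3 * b3 * axis k 1 $ 3 = 0"
      by (simp add: T_def mult_3 X3 algebra_simps)
    then show False using k b exhaust_3[of k] by (auto simp: axis_def)
  qed
qed

end
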